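(* Let $W$ be a weighing matrix $W(23,16)$. Then the graph $\Gamma(W)$ contains at least one edge.
   Context: A weighing matrix $W(n,k)$ is an $n\times n$ matrix $W$ with entries in $\{0,1,-1\}$ whose rows are pairwise orthogonal and have length $\sqrt{k}$, i.e. $WW^T=kI_n$. For a weighing matrix $W$ of type $W(23,16)$ and $i\in\{1,\ldots,23\}$, let $L_i\subseteq\{1,\ldots,23\}$ (the $i$-th "line") be the set of column positions at which the $i$-th row of $W$ is zero. The graph $\Gamma(W)$ is the simple graph with vertex set $\{1,2,\ldots,23\}$ in which distinct $i$ and $j$ are joined by an edge if and only if $|L_i\cap L_j|=1$. *)

theory Defs
  imports "Jordan_Normal_Form.Matrix" "Graph_Theory.Pair_Digraph"
begin

definition weighing_matrix :: "nat \<Rightarrow> nat \<Rightarrow> int mat \<Rightarrow> bool" where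
  "weighing_matrix n k W \<longleftrightarrow>
     W \<in> carrier_mat n n \<and> elements_mat W \<subseteq> {0, 1, -1} \<and>
     W * transpose_mat W = int k \<cdot>\<^sub>m 1\<^sub>m n"

text \<open>Rows, columns and vertices are numbered from 1; matrix entries are indexed from 0,
  whence the shift.\<close>

definition zero_line :: "int mat \<Rightarrow> nat \<Rightarrow> nat set" where
  "zero_line W i = {j \<in> {1..dim_col W}. W $$ (i - 1, j - 1) = 0}"

text \<open>An undirected edge between \<open>i\<close> and \<open>j\<close> is represented by the two arcs
  \<open>(i, j)\<close> and \<open>(j, i)\<close>.\<close>

definition Gamma :: "int mat \<Rightarrow> nat pair_pre_digraph" where
  "Gamma W =
     \<lparr>pverts = {1..dim_row W},
      parcs = {(i, j). i \<in> {1..dim_row W} \<and> j \<in> {1..dim_row W} \<and> i \<noteq> j \<and>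
                       card (zero_line W i \<inter> zero_line W j) = 1}\<rparr>"

lemma pair_graph_Gamma: "pair_graph (Gamma W)"
proof
  show "finite (pverts (Gamma W))"
    by (simp add: Gamma_def)
  have "parcs (Gamma W) \<subseteq> {1..dim_row W} \<times> {1..dim_row W}"
    by (auto simp: Gamma_def)
  then show "finite (parcs (Gamma W))"
    by (rule finite_subset) simp
  show "symmetric (with_proj (Gamma W))"
    by (auto simp: symmetric_def sym_def Gamma_def arcs_ends_def arc_to_ends_def Int_commute)
qed (auto simp: Gamma_def)

end

theory Submission
  imports Defs "Jordan_Normal_Form.Determinant"
begin

text \<open>Two distinct lines of a \<open>W(23,16)\<close> meet in an odd number of points: orthogonality forces the
  supports of the two rows to share an even number of columns, and that number is
  \<open>23 - 2 \<cdot> 7\<close> plus the size of the intersection of the lines. The columns of \<open>W\<close> also have 7 zeros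
  each, so the 22 other lines meet a given line in \<open>7 \<cdot> 6 = 42\<close> incidences altogether. As
  \<open>42 < 22 \<cdot> 3\<close>, some intersection is a single point.\<close>

text \<open>Over the rationals a one-sided inverse of a square matrix is two-sided, so
  \<open>transpose_mat W\<close>, scaled by 1/k, commutes with \<open>W\<close>. Injectivity of
  \<open>of_int\<close> brings the identity back to the integers. This gives access to the columns
  of \<open>W\<close>.\<close>

lemma weighing_matrix_transpose:
  assumes W: "weighing_matrix n k W" and k: "k > 0"
  shows "weighing_matrix n k (transpose_mat W)"
proof -
  define A :: "rat mat" where "A = map_mat of_int W"
  define B :: "rat mat" where "B = (1 / of_nat k) \<cdot>\<^sub>m transpose_mat A"
  have carW: "W \<in> carrier_mat n n" and eW: "W * transpose_mat W = int k \<cdot>\<^sub>m 1\<^sub>m n"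
    and el: "elements_mat W \<subseteq> {0, 1, -1}"
    using W by (auto simp: weighing_matrix_def)
  have carA: "A \<in> carrier_mat n n" and carB: "B \<in> carrier_mat n n"
    using carW by (auto simp: A_def B_def)
  have map_one: "map_mat of_int (int k \<cdot>\<^sub>m 1\<^sub>m n) = (of_nat k \<cdot>\<^sub>m 1\<^sub>m n :: rat mat)"
    by (intro eq_matI) auto
  have "A * transpose_mat A = map_mat of_int (W * transpose_mat W)"
    unfolding A_def using carW by (simp add: of_int_hom.mat_hom_mult map_mat_transpose)
  then have "A * transpose_mat A = of_nat k \<cdot>\<^sub>m 1\<^sub>m n"
    by (simp add: eW map_one)
  then have "A * B = 1\<^sub>m n"
    unfolding B_def using carA k by (simp add: mult_smult_distrib[of _ n n _ n]) (intro eq_matI, auto)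
  then have BA: "B * A = 1\<^sub>m n"
    by (rule mat_mult_left_right_inverse[OF carA carB])
  have "transpose_mat A * A = of_nat k \<cdot>\<^sub>m (B * A)"
    unfolding B_def using carA k
    by (simp add: mult_smult_assoc_mat[of _ n n _ n]) (intro eq_matI, auto)
  then have "map_mat of_int (transpose_mat W * W) = (map_mat of_int (int k \<cdot>\<^sub>m 1\<^sub>m n) :: rat mat)"
    using carW by (simp add: BA[unfolded A_def] map_one A_def of_int_hom.mat_hom_mult map_mat_transpose)
  then have "transpose_mat W * W = int k \<cdot>\<^sub>m 1\<^sub>m n"
    by (rule of_int_hom.mat_hom_inj)
  moreover have "elements_mat (transpose_mat W) \<subseteq> elements_mat W"
    by (fastforce simp: elements_mat_def)
  ultimately show ?thesis
    using carW el by (auto simp: weighing_matrix_def)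
qed

text \<open>The 0-based counterpart of \<open>zero_line\<close>, free of the shift by one.\<close>

definition row_zeros :: "int mat \<Rightarrow> nat \<Rightarrow> nat set" where
  "row_zeros W i = {l. l < dim_col W \<and> W $$ (i, l) = 0}"

lemma finite_row_zeros [simp]: "finite (row_zeros W i)"
  by (simp add: row_zeros_def)

lemma zero_line_Suc: "zero_line W (Suc i) = Suc ` row_zeros W i"
proof (rule Set.set_eqI)
  fix x show "x \<in> zero_line W (Suc i) \<longleftrightarrow> x \<in> Suc ` row_zeros W i"
    by (cases x) (auto simp: zero_line_def row_zeros_def)
qed

lemma card_zero_line_Int:
  "card (zero_line W (Suc i) \<inter> zero_line W (Suc j)) = card (row_zeros W i \<inter> row_zeros W j)"
  by (simp add: zero_line_Suc image_Int[symmetric] card_image)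

lemma weighing_matrix_entry:
  assumes "weighing_matrix n k W" "i < n" "j < n"
  shows "W $$ (i, j) \<in> {0, 1, -1}"
  using assms unfolding weighing_matrix_def elements_mat_def by fastforce

lemma weighing_matrix_row_product:
  assumes "weighing_matrix n k W" "i < n" "j < n"
  shows "(\<Sum>l<n. W $$ (i, l) * W $$ (j, l)) = (if i = j then int k else 0)"
proof -
  have car: "W \<in> carrier_mat n n" and e: "W * transpose_mat W = int k \<cdot>\<^sub>m 1\<^sub>m n"
    using assms by (auto simp: weighing_matrix_def)
  have "(W * transpose_mat W) $$ (i, j) = (\<Sum>l<n. W $$ (i, l) * W $$ (j, l))"
    using car assms by (simp add: scalar_prod_def atLeast0LessThan)
  then show ?thesis
    unfolding e using assms by (cases "i = j") auto
qed

lemma row_support: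
  assumes "weighing_matrix n k W"
  shows "{l. l < n \<and> W $$ (i, l) \<noteq> 0} = {..<n} - row_zeros W i"
    and "row_zeros W i \<subseteq> {..<n}"
  using assms by (auto simp: weighing_matrix_def row_zeros_def)

text \<open>Squares of entries are 0 or 1, so the inner product of a row with itself counts its
  support.\<close>

lemma card_row_zeros:
  assumes W: "weighing_matrix n k W" and i: "i < n"
  shows "card (row_zeros W i) + k = n"
proof -
  have "int k = (\<Sum>l<n. W $$ (i, l) * W $$ (i, l))"
    using weighing_matrix_row_product[OF W i i] by simp
  also have "\<dots> = (\<Sum>l<n. if W $$ (i, l) \<noteq> 0 then 1 else 0)"
    using weighing_matrix_entry[OF W i] by (intro sum.cong) fastforce+
  also have "\<dots> = int (card {l. l < n \<and> W $$ (i, l) \<noteq> 0})"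
    by (simp add: sum.If_cases Int_def)
  finally have "k = card ({..<n} - row_zeros W i)"
    by (simp add: row_support[OF W])
  then show ?thesis
    using row_support(2)[OF W, of i] card_mono[OF _ row_support(2)[OF W, of i]]
    by (simp add: card_Diff_subset)
qed

text \<open>The inner product 0 is a sum of terms 1 or -1, one for each column of the common
  support; a sum of odd numbers is even only if their number is even.\<close>

lemma even_card_support_Int:
  assumes W: "weighing_matrix n k W" and ij: "i < n" "j < n" "i \<noteq> j"
  shows "even (card ({..<n} - (row_zeros W i \<union> row_zeros W j)))"
proof -
  let ?S = "{..<n} - (row_zeros W i \<union> row_zeros W j)"
  have "0 = (\<Sum>l<n. W $$ (i, l) * W $$ (j, l))"
    using weighing_matrix_row_product[OF W, of i j] ij by simp
  also have "\<dots> = (\<Sum>l\<in>?S. W $$ (i, l) * W $$ (j, l))"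
    using W by (intro sum.mono_neutral_right) (auto simp: row_zeros_def weighing_matrix_def)
  finally have "even (\<Sum>l\<in>?S. W $$ (i, l) * W $$ (j, l))"
    by simp
  moreover have "{l \<in> ?S. odd (W $$ (i, l) * W $$ (j, l))} = ?S"
  proof -
    have "odd (W $$ (i, l) * W $$ (j, l))" if "l \<in> ?S" for l
    proof -
      have "W $$ (i, l) \<noteq> 0" "W $$ (j, l) \<noteq> 0"
        using that W by (auto simp: row_zeros_def weighing_matrix_def)
      then show ?thesis
        using weighing_matrix_entry[OF W, of i l] weighing_matrix_entry[OF W, of j l] ij that
        by auto
    qed
    then show ?thesis by blast
  qed
  ultimately show ?thesis
    by (simp only: even_sum_iff[OF finite_Diff[OF finite_lessThan]])
qed

text \<open>By inclusion-exclusion, union and intersection sizes add up to the even number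
  \<open>2 * (n - k)\<close>, so they have equal parity; the complement of the union is the common
  support, of even size.\<close>

lemma card_row_zeros_Int_parity:
  assumes W: "weighing_matrix n k W" and ij: "i < n" "j < n" "i \<noteq> j"
  shows "even (card (row_zeros W i \<inter> row_zeros W j)) \<longleftrightarrow> even n"
proof -
  let ?U = "row_zeros W i \<union> row_zeros W j"
  have "?U \<subseteq> {..<n}"
    using row_support(2)[OF W] by blast
  then have "card ({..<n} - ?U) + card ?U = n"
    using card_mono[of "{..<n}" ?U] by (simp add: card_Diff_subset)
  moreover have "card ?U + card (row_zeros W i \<inter> row_zeros W j) = 2 * (n - k)"
    using card_Un_Int[of "row_zeros W i" "row_zeros W j"]
      card_row_zeros[OF W ij(1)] card_row_zeros[OF W ij(2)] by simp
  ultimately show ?thesis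
    using even_card_support_Int[OF W ij] by (metis even_add even_mult_iff even_numeral)
qed

text \<open>Double counting: each of the \<open>n - k\<close> zeros of row \<open>i\<close> lies in
  a column with \<open>n - k\<close> zeros. The term \<open>j = i\<close> is included.\<close>

lemma sum_card_row_zeros_Int:
  assumes W: "weighing_matrix n k W" and k: "k > 0" and i: "i < n"
  shows "(\<Sum>j<n. card (row_zeros W i \<inter> row_zeros W j)) = (n - k) ^ 2"
proof -
  let ?Z = "row_zeros W i"
  have W': "weighing_matrix n k (transpose_mat W)"
    by (rule weighing_matrix_transpose[OF W k])
  have car: "W \<in> carrier_mat n n"
    using W by (simp add: weighing_matrix_def)
  have col: "card {j \<in> {..<n}. l \<in> row_zeros W j} = n - k" if "l \<in> ?Z" for l
  proof -
    have "l < n"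
      using that row_support(2)[OF W] by blast
    moreover from this have "{j \<in> {..<n}. l \<in> row_zeros W j} = row_zeros (transpose_mat W) l"
      using car by (auto simp: row_zeros_def)
    ultimately show ?thesis
      using card_row_zeros[OF W', of l] by simp
  qed
  have "(\<Sum>j<n. card {l \<in> ?Z. l \<in> row_zeros W j}) = (n - k) * card ?Z"
    by (rule sum_multicount) (use col in auto)
  then show ?thesis
    using card_row_zeros[OF W i] by (auto simp: Int_def power2_eq_square)
qed

theorem proposition1:
  fixes W :: "int mat"
  assumes "weighing_matrix 23 16 W"
  shows "parcs (Gamma W) \<noteq> {}"
proof
  assume empty: "parcs (Gamma W) = {}"
  \<comment> \<open>Row 0, which is vertex 1, serves as the fixed line.\<close>
  let ?c = "\<lambda>j. card (row_zeros W 0 \<inter> row_zeros W j)"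
  have dim: "dim_row W = 23"
    using assms by (auto simp: weighing_matrix_def)
  have three: "3 \<le> ?c j" if j: "j \<in> {..<23} - {0}" for j
  proof -
    have "odd (?c j)"
      using card_row_zeros_Int_parity[OF assms, of 0 j] j by simp
    moreover have "?c j \<noteq> 1"
    proof
      assume "?c j = 1"
      then have "(Suc 0, Suc j) \<in> parcs (Gamma W)"
        using j dim by (simp add: Gamma_def card_zero_line_Int)
      with empty show False by simp
    qed
    ultimately show ?thesis by presburger
  qed
  have "22 * 3 \<le> (\<Sum>j\<in>{..<23} - {0}. ?c j)"
    using sum_bounded_below[of "{..<23} - {0}" 3 ?c] three by simp
  \<comment> \<open>Adding the term \<open>j = 0\<close>, which is 7, turns the exact count 42 into
    49, still below 66.\<close>
  also have "\<dots> \<le> (\<Sum>j<23. ?c j)"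
    by (rule sum_mono2) auto
  also have "\<dots> = 49"
    using sum_card_row_zeros_Int[OF assms, of 0] by simp
  finally show False by simp
qed

end
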